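(* Let $a,b,c\in\mathbb{R}$ with $b<a^2/3$, let $c_0=-\frac{2}{27}a^3+\frac13 ab$, $c_1=c_0+\frac{2}{27}\sqrt{(a^2-3b)^3}$ and $c_2=c_0-\frac{2}{27}\sqrt{(a^2-3b)^3}$, and suppose $c\in[c_2,c_1]$. Then the polynomial $p(x)=x^3+ax^2+bx+c$ has three real roots (counted with multiplicity) $x_3\le x_2\le x_1$, at least two of which are different, and any two of which are not farther apart than $\frac{\sqrt{12}}{3}\sqrt{a^2-3b}$. Moreover, the roots lie in the following intervals: (I) if $c_2\le c\le c_0$, then $x_3\in[\nu_3,\mu_2]$, $x_2\in[\mu_2,\phi]$, and $x_1\in[\nu_1,\xi_2]$; (II) if $c_0\le c\le c_1$, then $x_3\in[\xi_1,\nu_3]$, $x_2\in[\phi,\mu_1]$, and $x_1\in[\mu_1,\nu_1]$; where: (i) for $i=1,2$, $\mu_i$ is the double root and $\xi_i$ is the simple root of $p_i(x)=x^3+ax^2+bx+c_i$; that is, $\mu_1,\mu_2$ are the roots of $p'(x)=3x^2+2ax+b$, namely $\mu_1=-\frac a3+\frac13\sqrt{a^2-3b}$, $\mu_2=-\frac a3-\frac13\sqrt{a^2-3b}$, and $\xi_1=-a-2\mu_1=-\frac a3-\frac23\sqrt{a^2-3b}$, $\xi_2=-a-2\mu_2=-\frac a3+\frac23\sqrt{a^2-3b}$; (ii) $\nu_1,\nu_2,\nu_3$ are the roots of $p_0(x)=x^3+ax^2+bx+c_0$, namely $\nu_1=-\frac a3+\frac{\sqrt3}{3}\sqrt{a^2-3b}$,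 $\nu_2=\phi=-\frac a3$, and $\nu_3=-\frac a3-\frac{\sqrt3}{3}\sqrt{a^2-3b}$.
   Context: All coefficients are real. The formulas in (i) and (ii) for $\mu_i,\xi_i,\nu_j,\phi$ may be taken as definitions; the claims that they are the stated (double, simple) roots of $p_1,p_2,p_0$ and $p'$ are part of the theorem. *)

theory Defs
  imports Complex_Main "HOL-Computational_Algebra.Polynomial"
begin

end

theory Submission
  imports Defs
begin

text \<open>
  Writing \<open>x = t - a/3\<close> and \<open>r = sqrt (a\<^sup>2 - 3 b) / 3\<close> turns the polynomial into the depressed cubic
  \<open>t\<^sup>3 - 3 r\<^sup>2 t + d\<close> with \<open>d = c - c0\<close> and \<open>\<bar>d\<bar> \<le> 2 r\<^sup>3\<close>. For \<open>d \<ge> 0\<close> its signs at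
  \<open>-2r, -\<surd>3 r, 0, r\<close> give two roots by the intermediate value theorem; the third one is minus
  their sum, and it is located by Vieta's relation \<open>t\<^sub>1\<^sup>2 + t\<^sub>1 t\<^sub>2 + t\<^sub>2\<^sup>2 = 3 r\<^sup>2\<close>. The case \<open>d \<le> 0\<close>
  follows by negating all roots. The bound on the distances comes from the identity
  \<open>(t\<^sub>1 - t\<^sub>3)\<^sup>2 = 12 r\<^sup>2 - 3 t\<^sub>2\<^sup>2\<close>.
\<close>

text \<open>Vieta's identities turn the cubic into a product of three linear factors, so claims
  about roots with multiplicity reduce to checking three equations.\<close>

lemma proots_cubic_factored:
  fixes x1 x2 x3 :: "'a::idom"
  assumes "a = - (x1 + x2 + x3)" and "b = x1 * x2 + x1 * x3 + x2 * x3" and "c = - (x1 * x2 * x3)"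
  shows "proots [:c, b, a, 1:] = {#x1, x2, x3#}"
proof -
  have "[:c, b, a, 1:] = [:-x1, 1:] * ([:-x2, 1:] * [:-x3, 1:])"
    using assms by (simp add: algebra_simps)
  also have "proots \<dots> = proots [:-x1, 1:] + (proots [:-x2, 1:] + proots [:-x3, 1:])"
    by (simp add: proots_mult del: mult_pCons_left mult_pCons_right)
  finally show ?thesis by simp
qed

lemma depressed_cubic_roots:
  fixes r d :: real
  assumes r: "0 < r" and d: "0 \<le> d" "d \<le> 2 * r^3"
  obtains t1 t2 t3 where "t1 + t2 + t3 = 0" "t1 * t2 + t1 * t3 + t2 * t3 = - 3 * r^2"
    "t1 * t2 * t3 = - d" "t3 \<in> {-2 * r..- sqrt 3 * r}" "t2 \<in> {0..r}" "t1 \<in> {r..sqrt 3 * r}"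
proof -
  define f where "f t = t^3 - 3 * r^2 * t + d" for t :: real
  have cont: "continuous_on S f" for S
    unfolding f_def by (intro continuous_intros)
  \<comment> \<open>At both \<open>-2 * r\<close> and \<open>r\<close> the value of \<open>f\<close>
    is \<open>d - 2 * r^3\<close>, which is where the upper bound on \<open>d\<close> enters; at
    \<open>- sqrt 3 * r\<close> and \<open>0\<close> it is \<open>d\<close>.\<close>
  have "f (-2 * r) \<le> 0" using d by (simp add: f_def power3_eq_cube power2_eq_square)
  moreover have "f (- sqrt 3 * r) = d"
    by (simp add: f_def power3_eq_cube power2_eq_square)
  moreover have "sqrt 3 \<le> 2" by (rule real_le_lsqrt) auto
  ultimately obtain t3 where t3: "-2 * r \<le> t3" "t3 \<le> - sqrt 3 * r" "f t3 = 0"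
    using IVT'[of f "-2 * r" 0 "- sqrt 3 * r"] cont r d by auto
  have "f 0 \<ge> 0" "f r \<le> 0"
    using d by (auto simp: f_def power3_eq_cube power2_eq_square)
  then obtain t2 where t2: "0 \<le> t2" "t2 \<le> r" "f t2 = 0"
    using IVT2'[of f r 0 0] cont r by auto
  define t1 where "t1 = - t2 - t3"
  have "sqrt 3 * r > 0" using r by simp
  then have "t3 < 0" using t3 by linarith
  \<comment> \<open>The left side is \<open>f t2 - f t3\<close>. The factor \<open>t2 - t3\<close>
    can be cancelled because \<open>t3 < 0 \<le> t2\<close>.\<close>
  have "(t2 - t3) * (t2^2 + t2 * t3 + t3^2 - 3 * r^2) = 0"
    using t2(3) t3(3) by (simp add: f_def algebra_simps power3_eq_cube power2_eq_square)
  with \<open>t3 < 0\<close> t2 have quad: "t2^2 + t2 * t3 + t3^2 = 3 * r^2" by auto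
  have quad1: "t1^2 + t1 * t2 + t2^2 = 3 * r^2"
    using quad by (simp add: t1_def algebra_simps power2_eq_square)
  have "1 \<le> sqrt 3" by simp
  then have "r \<le> sqrt 3 * r" using r by simp
  then have "t1 \<ge> 0" using t2 t3 unfolding t1_def by linarith
  show thesis
  proof
    show "t1 + t2 + t3 = 0" by (simp add: t1_def)
    show "t1 * t2 + t1 * t3 + t2 * t3 = - 3 * r^2"
      using quad by (simp add: t1_def algebra_simps power2_eq_square)
    \<comment> \<open>With \<open>quad\<close> the right side becomes
      \<open>t3^3 - 3 * r^2 * t3\<close>, which is \<open>f t3 - d\<close>.\<close>
    have "t1 * t2 * t3 = t3^3 - (t2^2 + t2 * t3 + t3^2) * t3"
      by (simp add: t1_def algebra_simps power2_eq_square power3_eq_cube)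
    then show "t1 * t2 * t3 = - d" using t3(3) unfolding quad f_def by simp
    have "0 \<le> t1 * t2" "0 \<le> t2^2" using \<open>t1 \<ge> 0\<close> t2 by simp_all
    then have "t1^2 \<le> 3 * r^2" using quad1 by linarith
    then have "t1^2 \<le> (sqrt 3 * r)^2" by (simp add: power_mult_distrib)
    then have "t1 \<le> sqrt 3 * r" by (rule power2_le_imp_le) (use r in simp)
    moreover have "r \<le> t1"
    \<comment> \<open>If \<open>t1 < r\<close>, then, as \<open>t2 \<le> r\<close>, each term on the
      left of \<open>quad1\<close> is at most \<open>r^2\<close> and the first is strictly smaller,
      so their sum stays below \<open>3 * r^2\<close>.\<close>
    proof (rule ccontr)
      assume "\<not> r \<le> t1"
      then have "t1^2 < r^2" "t1 * t2 \<le> r * r" "t2^2 \<le> r^2"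
        using \<open>t1 \<ge> 0\<close> t2 r by (simp_all add: power_strict_mono mult_mono power_mono)
      then show False using quad1 by (simp add: power2_eq_square)
    qed
    ultimately show "t1 \<in> {r..sqrt 3 * r}" by simp
  qed (use t2 t3 in auto)
qed

lemma depressed_cubic_root_dist:
  fixes r t1 t2 t3 :: real
  assumes r: "0 \<le> r" and sum: "t1 + t2 + t3 = 0" and prod: "t1 * t2 + t1 * t3 + t2 * t3 = - 3 * r^2"
  shows "\<bar>t1 - t3\<bar> \<le> sqrt 12 * r"
proof -
  have t2: "t2 = - t1 - t3" using sum by simp
  have "(t1 - t3)^2 = 12 * r^2 - 3 * t2^2"
    using prod unfolding t2 by (simp add: algebra_simps power2_eq_square)
  then have "\<bar>t1 - t3\<bar>^2 \<le> (sqrt 12 * r)^2" by (simp add: power_mult_distrib)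
  then show ?thesis by (rule power2_le_imp_le) (use r in simp)
qed

theorem theorem1:
  fixes a b c c0 c1 c2 \<mu>1 \<mu>2 \<xi>1 \<xi>2 \<nu>1 \<nu>2 \<nu>3 \<phi> :: real
    and p p0 p1 p2 :: "real poly"
  assumes b: "b < a^2 / 3"
    and c0: "c0 = - (2/27) * a^3 + (1/3) * a * b"
    and c1: "c1 = c0 + (2/27) * sqrt ((a^2 - 3 * b)^3)"
    and c2: "c2 = c0 - (2/27) * sqrt ((a^2 - 3 * b)^3)"
    and c: "c \<in> {c2..c1}"
    and p: "p = [:c, b, a, 1:]"
    and p0: "p0 = [:c0, b, a, 1:]"
    and p1: "p1 = [:c1, b, a, 1:]"
    and p2: "p2 = [:c2, b, a, 1:]"
    and \<mu>1: "\<mu>1 = - a/3 + (1/3) * sqrt (a^2 - 3 * b)"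
    and \<mu>2: "\<mu>2 = - a/3 - (1/3) * sqrt (a^2 - 3 * b)"
    and \<xi>1: "\<xi>1 = - a/3 - (2/3) * sqrt (a^2 - 3 * b)"
    and \<xi>2: "\<xi>2 = - a/3 + (2/3) * sqrt (a^2 - 3 * b)"
    and \<phi>: "\<phi> = - a/3"
    and \<nu>1: "\<nu>1 = - a/3 + (sqrt 3 / 3) * sqrt (a^2 - 3 * b)"
    and \<nu>2: "\<nu>2 = \<phi>"
    and \<nu>3: "\<nu>3 = - a/3 - (sqrt 3 / 3) * sqrt (a^2 - 3 * b)"
  shows "(\<exists>x1 x2 x3. proots p = {#x1, x2, x3#} \<and> x3 \<le> x2 \<and> x2 \<le> x1
            \<and> (x1 \<noteq> x2 \<or> x1 \<noteq> x3 \<or> x2 \<noteq> x3)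
            \<and> (\<forall>x\<in>{x1, x2, x3}. \<forall>y\<in>{x1, x2, x3}.
                  \<bar>x - y\<bar> \<le> (sqrt 12 / 3) * sqrt (a^2 - 3 * b))
            \<and> (c2 \<le> c \<and> c \<le> c0 \<longrightarrow>
                  x3 \<in> {\<nu>3..\<mu>2} \<and> x2 \<in> {\<mu>2..\<phi>} \<and> x1 \<in> {\<nu>1..\<xi>2})
            \<and> (c0 \<le> c \<and> c \<le> c1 \<longrightarrow>
                  x3 \<in> {\<xi>1..\<nu>3} \<and> x2 \<in> {\<phi>..\<mu>1} \<and> x1 \<in> {\<mu>1..\<nu>1}))
       \<and> (\<forall>x. order x p1 = 2 \<longleftrightarrow> x = \<mu>1) \<and> (\<forall>x. order x p1 = 1 \<longleftrightarrow> x = \<xi>1)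
       \<and> (\<forall>x. order x p2 = 2 \<longleftrightarrow> x = \<mu>2) \<and> (\<forall>x. order x p2 = 1 \<longleftrightarrow> x = \<xi>2)
       \<and> pderiv p = [:b, 2 * a, 3:] \<and> proots (pderiv p) = {#\<mu>1, \<mu>2#}
       \<and> \<xi>1 = - a - 2 * \<mu>1 \<and> \<xi>2 = - a - 2 * \<mu>2
       \<and> proots p0 = {#\<nu>1, \<nu>2, \<nu>3#}"
proof -
  define r where "r = sqrt (a^2 - 3 * b) / 3"
  have s: "sqrt (a^2 - 3 * b) = 3 * r" by (simp add: r_def)
  have r: "0 < r" using b by (simp add: r_def)
  have "(sqrt (a^2 - 3 * b))^2 = a^2 - 3 * b" using b by simp
  then have b_r: "b = a^2 / 3 - 3 * r^2" unfolding s by (simp add: power2_eq_square)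
  have c0_r: "c0 = a^3 / 27 - a * r^2"
    unfolding c0 b_r by (simp add: algebra_simps power2_eq_square power3_eq_cube)
  \<comment> \<open>The root of the cube is \<open>(3 * r)^3 = 27 * r^3\<close>, so the condition on
    \<open>c\<close> says that \<open>c - c0\<close> has absolute value at most
    \<open>2 * r^3\<close>.\<close>
  have c1_r: "c1 = c0 + 2 * r^3" and c2_r: "c2 = c0 - 2 * r^3"
    unfolding c1 c2 real_sqrt_power s by (simp_all add: power3_eq_cube)
  have pts: "\<mu>1 = r - a/3" "\<mu>2 = - r - a/3" "\<xi>1 = - 2 * r - a/3" "\<xi>2 = 2 * r - a/3"
    "\<nu>1 = sqrt 3 * r - a/3" "\<nu>3 = - sqrt 3 * r - a/3"
    unfolding \<mu>1 \<mu>2 \<xi>1 \<xi>2 \<nu>1 \<nu>3 s by simp_all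
  \<comment> \<open>Stated for arbitrary \<open>d\<close>, this undoes the substitution for
    \<open>p\<close>, \<open>p0\<close>, \<open>p1\<close> and \<open>p2\<close> alike.\<close>
  have shifted: "proots [:c0 + d, b, a, 1:] = {#t1 - a/3, t2 - a/3, t3 - a/3#}"
    if "t1 + t2 + t3 = 0" "t1 * t2 + t1 * t3 + t2 * t3 = - 3 * r^2" "t1 * t2 * t3 = - d"
    for d t1 t2 t3
  proof (rule proots_cubic_factored)
    have t3: "t3 = - t1 - t2" using that(1) by simp
    \<comment> \<open>Eliminating \<open>r^2\<close> first and \<open>t3\<close> afterwards leaves
      polynomial identities in \<open>a\<close>, \<open>t1\<close> and \<open>t2\<close>.\<close>
    have r2: "r^2 = - (t1 * t2 + t1 * t3 + t2 * t3) / 3" using that(2) by simp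
    have d: "d = - (t1 * t2 * t3)" using that(3) by simp
    show "a = - (t1 - a/3 + (t2 - a/3) + (t3 - a/3))" using that(1) by simp
    show "b = (t1 - a/3) * (t2 - a/3) + (t1 - a/3) * (t3 - a/3) + (t2 - a/3) * (t3 - a/3)"
      unfolding b_r r2 unfolding t3 by (simp add: field_simps power2_eq_square)
    show "c0 + d = - ((t1 - a/3) * (t2 - a/3) * (t3 - a/3))"
      unfolding c0_r d r2 unfolding t3 by (simp add: field_simps power2_eq_square power3_eq_cube)
  qed
  have p0_roots: "proots p0 = {#\<nu>1, \<nu>2, \<nu>3#}"
    using shifted[of "sqrt 3 * r" 0 "- sqrt 3 * r" 0]
    by (simp add: p0 pts \<nu>2 \<phi> power2_eq_square)
  \<comment> \<open>The extreme values of \<open>d\<close> give double roots: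
    \<open>t^3 - 3 * r^2 * t + 2 * r^3 = (t - r)^2 * (t + 2 * r)\<close>, and its mirror image for
    \<open>p2\<close>.\<close>
  have p1_roots: "proots p1 = {#\<mu>1, \<mu>1, \<xi>1#}"
    using shifted[of r r "- 2 * r" "2 * r^3"]
    by (simp add: p1 c1_r pts power2_eq_square power3_eq_cube)
  have p2_roots: "proots p2 = {#\<mu>2, \<mu>2, \<xi>2#}"
    using shifted[of "- r" "- r" "2 * r" "- 2 * r^3"]
    by (simp add: p2 c2_r pts power2_eq_square power3_eq_cube)
  have ne: "\<mu>1 \<noteq> \<xi>1" "\<mu>2 \<noteq> \<xi>2" using r by (simp_all add: pts)
  have "order x p1 = count {#\<mu>1, \<mu>1, \<xi>1#} x" "order x p2 = count {#\<mu>2, \<mu>2, \<xi>2#} x" for x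
    by (simp_all flip: p1_roots p2_roots) (simp_all add: p1 p2)
  then have orders:
    "(\<forall>x. order x p1 = 2 \<longleftrightarrow> x = \<mu>1) \<and> (\<forall>x. order x p1 = 1 \<longleftrightarrow> x = \<xi>1)
     \<and> (\<forall>x. order x p2 = 2 \<longleftrightarrow> x = \<mu>2) \<and> (\<forall>x. order x p2 = 1 \<longleftrightarrow> x = \<xi>2)"
    using ne by auto
  have pd: "pderiv p = [:b, 2 * a, 3:]" by (simp add: p pderiv_pCons)
  also have "\<dots> = smult 3 ([:-\<mu>1, 1:] * [:-\<mu>2, 1:])"
    by (simp add: pts b_r field_simps power2_eq_square)
  also have "proots \<dots> = proots [:-\<mu>1, 1:] + proots [:-\<mu>2, 1:]"
    by (simp add: proots_mult del: mult_pCons_left mult_pCons_right)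
  finally have pd_roots: "proots (pderiv p) = {#\<mu>1, \<mu>2#}" by simp

  have sqrt3: "1 \<le> sqrt 3" "sqrt 3 \<le> (2::real)" by (simp_all add: real_le_lsqrt)
  have sqrt3r: "r \<le> sqrt 3 * r" "sqrt 3 * r \<le> 2 * r"
    using r mult_right_mono[OF sqrt3(1)] mult_right_mono[OF sqrt3(2)] by simp_all
  have d: "c - c0 \<le> 2 * r^3" "- (c - c0) \<le> 2 * r^3" using c by (auto simp: c1_r c2_r)
  obtain t1 t2 t3 where t: "t1 + t2 + t3 = 0" "t1 * t2 + t1 * t3 + t2 * t3 = - 3 * r^2"
      "t1 * t2 * t3 = - (c - c0)"
    and low: "c \<le> c0 \<Longrightarrow> t3 \<in> {- sqrt 3 * r..- r} \<and> t2 \<in> {- r..0} \<and> t1 \<in> {sqrt 3 * r..2 * r}"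
    and high: "c0 \<le> c \<Longrightarrow> t3 \<in> {- 2 * r..- sqrt 3 * r} \<and> t2 \<in> {0..r} \<and> t1 \<in> {r..sqrt 3 * r}"
  \<comment> \<open>At \<open>c = c0\<close> one triple must satisfy both \<open>low\<close> and
    \<open>high\<close>, so there the roots are given explicitly.\<close>
  proof (cases c c0 rule: linorder_cases)
    case less
    then obtain u1 u2 u3 where u: "u1 + u2 + u3 = 0" "u1 * u2 + u1 * u3 + u2 * u3 = - 3 * r^2"
      "u1 * u2 * u3 = - (- (c - c0))" "u3 \<in> {-2 * r..- sqrt 3 * r}" "u2 \<in> {0..r}"
      "u1 \<in> {r..sqrt 3 * r}"
      using depressed_cubic_roots[OF r _ d(2)] by auto
    show ?thesis
      \<comment> \<open>Negation flips the sign of the product and reverses the order, hence the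
        swapped indices.\<close>
      by (rule that[of "- u3" "- u2" "- u1"]) (use u less in \<open>auto simp: algebra_simps\<close>)
  next
    case equal
    show ?thesis
      by (rule that[of "sqrt 3 * r" 0 "- sqrt 3 * r"])
        (use equal r sqrt3r in \<open>auto simp: power2_eq_square\<close>)
  next
    case greater
    then obtain u1 u2 u3 where u: "u1 + u2 + u3 = 0" "u1 * u2 + u1 * u3 + u2 * u3 = - 3 * r^2"
      "u1 * u2 * u3 = - (c - c0)" "u3 \<in> {-2 * r..- sqrt 3 * r}" "u2 \<in> {0..r}"
      "u1 \<in> {r..sqrt 3 * r}"
      using depressed_cubic_roots[OF r _ d(1)] by auto
    show ?thesis
      by (rule that[of u1 u2 u3]) (use u greater in auto)
  qed
  let ?x1 = "t1 - a/3" and ?x2 = "t2 - a/3" and ?x3 = "t3 - a/3"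
  have roots: "proots p = {#?x1, ?x2, ?x3#}" using shifted[OF t] by (simp add: p)
  have order: "t3 \<le> t2" "t2 \<le> t1" "t3 < t1" using low high r sqrt3r by (cases "c \<le> c0"; auto)+
  \<comment> \<open>Since the roots are ordered, the outermost pair bounds all other
    distances.\<close>
  have t13: "\<bar>t1 - t3\<bar> \<le> sqrt 12 * r"
    by (rule depressed_cubic_root_dist[OF _ t(1,2)]) (use r in simp)
  have "\<exists>x1 x2 x3. proots p = {#x1, x2, x3#} \<and> x3 \<le> x2 \<and> x2 \<le> x1
            \<and> (x1 \<noteq> x2 \<or> x1 \<noteq> x3 \<or> x2 \<noteq> x3)
            \<and> (\<forall>x\<in>{x1, x2, x3}. \<forall>y\<in>{x1, x2, x3}.
                  \<bar>x - y\<bar> \<le> (sqrt 12 / 3) * sqrt (a^2 - 3 * b))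
            \<and> (c2 \<le> c \<and> c \<le> c0 \<longrightarrow>
                  x3 \<in> {\<nu>3..\<mu>2} \<and> x2 \<in> {\<mu>2..\<phi>} \<and> x1 \<in> {\<nu>1..\<xi>2})
            \<and> (c0 \<le> c \<and> c \<le> c1 \<longrightarrow>
                  x3 \<in> {\<xi>1..\<nu>3} \<and> x2 \<in> {\<phi>..\<mu>1} \<and> x1 \<in> {\<mu>1..\<nu>1})"
  proof (intro exI conjI)
    show "proots p = {#?x1, ?x2, ?x3#}" by (fact roots)
    show "?x1 \<noteq> ?x2 \<or> ?x1 \<noteq> ?x3 \<or> ?x2 \<noteq> ?x3" using order by simp
    show "\<forall>x\<in>{?x1, ?x2, ?x3}. \<forall>y\<in>{?x1, ?x2, ?x3}.
        \<bar>x - y\<bar> \<le> (sqrt 12 / 3) * sqrt (a^2 - 3 * b)"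
      using order t13 unfolding s by auto
    show "c2 \<le> c \<and> c \<le> c0 \<longrightarrow> ?x3 \<in> {\<nu>3..\<mu>2} \<and> ?x2 \<in> {\<mu>2..\<phi>} \<and> ?x1 \<in> {\<nu>1..\<xi>2}"
      using low by (auto simp: pts \<phi>)
    show "c0 \<le> c \<and> c \<le> c1 \<longrightarrow> ?x3 \<in> {\<xi>1..\<nu>3} \<and> ?x2 \<in> {\<phi>..\<mu>1} \<and> ?x1 \<in> {\<mu>1..\<nu>1}"
      using high by (auto simp: pts \<phi>)
  qed (use order in auto)
  moreover have "\<xi>1 = - a - 2 * \<mu>1" "\<xi>2 = - a - 2 * \<mu>2" by (simp_all add: pts)
  ultimately show ?thesis using orders pd pd_roots p0_roots by blast
qed

end
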